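(* Let $q=r^2$, where $r$ is an odd prime power, and let $m$ be a positive integer with $m\mid q-1$. Let $t$ be an integer. If $1\leq t\leq\frac{r+1}{2\gcd(r+1,m)}$, $tm$ is odd and $n=tm+1$, then there exists an $[n,\frac{n}{2}]$ MDS self-dual code over $\mathbb{F}_{q}$.
   Context: $\mathbb{F}_q$ denotes the finite field with $q$ elements. An $[n,k,d]$ code over $\mathbb{F}_q$ (or $[n,k]$ code, when $d$ is not specified) is an $\mathbb{F}_q$-linear subspace $C\subseteq\mathbb{F}_q^n$ of dimension $k$ with minimum (Hamming) distance $d$. It is called MDS (maximum distance separable) if $k+d=n+1$. The dual $C^{\perp}$ is the orthogonal complement of $C$ in $\mathbb{F}_q^n$ with respect to the standard Euclidean bilinear form $\langle x,y\rangle=\sum_{i=1}^n x_iy_i$, and $C$ is self-dual if $C=C^{\perp}$. An MDS self-dual code of length $n$ thus has parameters $[n,\frac n2,\frac n2+1]$. *)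

theory Defs
  imports "HOL-Analysis.Analysis" "HOL-Number_Theory.Prime_Powers"
begin

definition bilin_form :: "'a::field ^ 'n \<Rightarrow> 'a ^ 'n \<Rightarrow> 'a" where
  "bilin_form x y = (\<Sum>i\<in>UNIV. x $ i * y $ i)"

definition dual_code :: "('a::field ^ 'n) set \<Rightarrow> ('a ^ 'n) set" where
  "dual_code C = {x. \<forall>y\<in>C. bilin_form x y = 0}"

definition self_dual :: "('a::field ^ 'n) set \<Rightarrow> bool" where
  "self_dual C \<longleftrightarrow> C = dual_code C"

definition hamming_dist :: "'a ^ 'n \<Rightarrow> 'a ^ 'n \<Rightarrow> nat" where
  "hamming_dist x y = card {i. x $ i \<noteq> y $ i}"

text \<open>Meaningful only for codes with at least two codewords: \<open>Min {}\<close> is unspecified. The set of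
  distances is always finite, being bounded by the length.\<close>

definition min_dist :: "('a ^ 'n) set \<Rightarrow> nat" where
  "min_dist C = Min {hamming_dist x y | x y. x \<in> C \<and> y \<in> C \<and> x \<noteq> y}"

text \<open>The length \<open>n\<close> of a code is the cardinality of the index type, and the base field is the
  type \<^typ>\<open>'a\<close>.\<close>

definition linear_code :: "nat \<Rightarrow> nat \<Rightarrow> ('a::field ^ 'n) set \<Rightarrow> bool" where
  "linear_code n k C \<longleftrightarrow> CARD('n) = n \<and> vec.subspace C \<and> vec.dim C = k"

definition MDS :: "('a::field ^ 'n) set \<Rightarrow> bool" where
  "MDS C \<longleftrightarrow> vec.dim C + min_dist C = CARD('n) + 1"

end

theory Submission
  imports Defs
begin

text \<open>A generalized Reed--Solomon code of dimension \<open>n / 2\<close> on \<open>n\<close> evaluation points \<open>S\<close> is MDS; by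
  Lagrange interpolation it can be rescaled to be self-dual as soon as every
  \<open>\<Prod>y\<in>S - {x}. x - y\<close> is a square. Let \<open>g = gcd (r + 1) m\<close>, let \<open>U\<close> consist of \<open>t\<close> roots of
  unity of order dividing \<open>(r + 1) / (2 * g)\<close>, and let \<open>S\<close> consist of \<open>0\<close> and the \<open>m\<close>-th roots of the
  elements of \<open>U\<close>. Evaluating the derivative of \<open>X * (\<Prod>u\<in>U. X ^ m - u)\<close> at the points of \<open>S\<close> reduces
  the condition to \<open>m\<close>, \<open>- 1\<close>, the elements of \<open>U\<close> and \<open>\<Prod>v\<in>U - {u}. u - v\<close> being squares. Since
  \<open>u ^ r = inverse u\<close> on \<open>U\<close>, the quadratic character of \<open>u - v\<close> does not depend on \<open>u\<close> and \<open>v\<close>,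
  and the product has \<open>t - 1\<close> factors, an even number.\<close>

section \<open>Generalized Reed--Solomon codes\<close>

lemma prod_linear_monic:
  fixes a :: "'b \<Rightarrow> 'a::idom"
  assumes "finite I"
  shows "degree (\<Prod>i\<in>I. [:- a i, 1:]) = card I" "lead_coeff (\<Prod>i\<in>I. [:- a i, 1:]) = 1"
proof -
  show "degree (\<Prod>i\<in>I. [:- a i, 1:]) = card I"
    by (subst degree_prod_eq_sum_degree) auto
  show "lead_coeff (\<Prod>i\<in>I. [:- a i, 1:]) = 1"
    by (simp add: lead_coeff_prod)
qed

text \<open>\<open>P\<close> equals its Lagrange interpolant \<open>Q\<close>, and each basis
  polynomial \<open>L i\<close> is monic of degree \<open>card I - 1\<close>, so comparing that
  coefficient gives the identity. The sum vanishes once \<open>degree P < card I - 1\<close>; this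
  is the source of orthogonality.\<close>

lemma sum_Lagrange_weights:
  fixes a :: "'b \<Rightarrow> 'a::field"
  assumes I: "finite I" and inj: "inj_on a I" and deg: "degree P < card I"
  shows "(\<Sum>i\<in>I. poly P (a i) / (\<Prod>j\<in>I - {i}. a i - a j)) = coeff P (card I - 1)"
proof -
  define w where "w i = (\<Prod>j\<in>I - {i}. a i - a j)" for i
  define L where "L i = (\<Prod>j\<in>I - {i}. [:- a j, 1:])" for i
  define Q where "Q = (\<Sum>i\<in>I. smult (poly P (a i) / w i) (L i))"
  have degL: "degree (L i) = card I - 1" and lcL: "coeff (L i) (card I - 1) = 1" if "i \<in> I" for i
    using prod_linear_monic[of "I - {i}" a] that I unfolding L_def by auto
  have w: "w i \<noteq> 0" if "i \<in> I" for i
    using that I inj by (auto simp: w_def inj_on_def)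
  have LL: "poly (L i) (a j) = (if i = j then w i else 0)" if "i \<in> I" "j \<in> I" for i j
    using that I by (auto simp: L_def w_def poly_prod)
  have val: "poly Q (a j) = poly P (a j)" if j: "j \<in> I" for j
  proof -
    have "poly Q (a j) = (\<Sum>i\<in>I. if i = j then poly P (a i) else 0)"
      unfolding Q_def poly_sum
      by (intro sum.cong refl) (use j w LL in auto)
    also have "\<dots> = poly P (a j)"
      using I j by simp
    finally show ?thesis .
  qed
  have "degree Q \<le> card I - 1"
    unfolding Q_def by (intro degree_sum_le I order.trans[OF degree_smult_le]) (simp add: degL)
  moreover have "card (a ` I) = card I"
    using inj by (rule card_image)
  ultimately have "P = Q"
    using val deg by (intro poly_eqI_degree[of "a ` I"]) auto
  then have "coeff P (card I - 1) = coeff Q (card I - 1)"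
    by simp
  also have "\<dots> = (\<Sum>i\<in>I. poly P (a i) / w i)"
    unfolding Q_def coeff_sum using lcL by (intro sum.cong) auto
  finally show ?thesis
    by (simp add: w_def)
qed

text \<open>As \<open>degree 0 = 0\<close>, the case \<open>k = 0\<close> yields the empty set
  instead of the zero code; hence the hypothesis \<open>0 < k\<close> in the lemmas on subspace and
  dimension.\<close>

definition grs :: "('n \<Rightarrow> 'a::field) \<Rightarrow> ('n \<Rightarrow> 'a) \<Rightarrow> nat \<Rightarrow> ('a ^ 'n) set" where
  "grs a v k = {\<chi> i. v i * poly p (a i) | p. degree p < k}"

lemma poly_eq_0_if_vanishes:
  fixes a :: "'n::finite \<Rightarrow> 'a::field"
  assumes "inj a" "degree p < CARD('n)" "\<And>i. poly p (a i) = 0"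
  shows "p = 0"
  using assms by (intro poly_eqI_degree[of "range a"]) (auto simp: card_image)

lemma grs_subspace:
  assumes "0 < k"
  shows "vec.subspace (grs a v k)"
proof -
  have "0 \<in> grs a v k"
    using assms by (auto simp: grs_def vec_eq_iff intro!: exI[of _ 0])
  moreover have "x + y \<in> grs a v k" if xy: "x \<in> grs a v k" "y \<in> grs a v k" for x y
  proof -
    obtain p q where "degree p < k" "degree q < k" "x = (\<chi> i. v i * poly p (a i))"
        "y = (\<chi> i. v i * poly q (a i))"
      using xy by (auto simp: grs_def)
    then show ?thesis
      unfolding grs_def
      by (intro CollectI exI[of _ "p + q"])
         (auto simp: vec_eq_iff algebra_simps intro!: degree_add_less)
  qed
  moreover have "c *s x \<in> grs a v k" if x: "x \<in> grs a v k" for x c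
  proof -
    obtain p where "degree p < k" "x = (\<chi> i. v i * poly p (a i))"
      using x by (auto simp: grs_def)
    then show ?thesis
      unfolding grs_def
      by (intro CollectI exI[of _ "smult c p"])
         (auto simp: vec_eq_iff intro!: order.strict_trans1[OF degree_smult_le])
  qed
  ultimately show ?thesis
    by (auto simp: vec.subspace_def)
qed

text \<open>The words of the monomials \<open>X ^ j\<close> with \<open>j < k\<close> form a basis:
  a relation among them is a polynomial of degree below \<open>k\<close> vanishing at
  \<open>CARD('n)\<close> distinct points, hence zero.\<close>

lemma grs_dim:
  fixes a :: "'n::finite \<Rightarrow> 'a::field"
  assumes inj: "inj a" and v: "\<And>i. v i \<noteq> 0" and k: "0 < k" "k \<le> CARD('n)"
  shows "vec.dim (grs a v k) = k"
proof -
  define c :: "nat \<Rightarrow> 'a ^ 'n" where "c j = (\<chi> i. v i * a i ^ j)" for j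
  have comb: "(\<Sum>j<k. f j *s c j) = (\<chi> i. v i * poly (\<Sum>j<k. monom (f j) j) (a i))" for f
    by (simp add: vec_eq_iff c_def poly_sum poly_monom sum_distrib_left mult_ac)
  have deg: "degree (\<Sum>j<k. monom (f j) j) < k" for f :: "nat \<Rightarrow> 'a"
    using k(1) by (intro degree_sum_less) (auto intro: order.strict_trans1[OF degree_monom_le])
  have zero: "f j = 0" if "(\<Sum>j<k. f j *s c j) = 0" "j < k" for f j
  proof -
    let ?p = "\<Sum>j<k. monom (f j) j"
    have "poly ?p (a i) = 0" for i
      using that(1) v unfolding comb by (simp add: vec_eq_iff)
    then have "?p = 0"
      using deg[of f] k(2) by (intro poly_eq_0_if_vanishes[OF inj]) auto
    then have "coeff ?p j = 0"
      by simp
    then show ?thesis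
      using that(2) by (simp add: coeff_sum)
  qed
  \<comment> \<open>Distinctness comes from \<open>zero\<close> as well: \<open>c x = c y\<close>
    would be a relation with coefficients 1 and - 1.\<close>
  have injc: "inj_on c {..<k}"
  proof (rule inj_onI, rule ccontr)
    fix x y assume xy: "x \<in> {..<k}" "y \<in> {..<k}" "c x = c y" "x \<noteq> y"
    let ?f = "\<lambda>j. if j = x then 1 else if j = y then - 1 else (0::'a)"
    have "(\<Sum>j<k. ?f j *s c j) = (\<Sum>j\<in>{x, y}. ?f j *s c j)"
      using xy by (intro sum.mono_neutral_right) auto
    also have "\<dots> = 0"
      using xy by simp
    finally show False
      using zero[of ?f x] xy by simp
  qed
  have "vec.independent (c ` {..<k})"
  proof (rule vec.independent_if_scalars_zero)
    fix f x assume "(\<Sum>x\<in>c ` {..<k}. f x *s x) = 0" and x: "x \<in> c ` {..<k}"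
    then have "(\<Sum>j<k. f (c j) *s c j) = 0"
      by (simp add: sum.reindex[OF injc])
    then show "f x = 0"
      using x zero[of "\<lambda>j. f (c j)"] by auto
  qed simp
  moreover have "c ` {..<k} \<subseteq> grs a v k"
  proof (rule image_subsetI)
    fix j assume "j \<in> {..<k}"
    then show "c j \<in> grs a v k"
      unfolding grs_def c_def
      by (intro CollectI exI[of _ "monom 1 j"]) (simp add: degree_monom_eq poly_monom)
  qed
  moreover have "grs a v k \<subseteq> vec.span (c ` {..<k})"
  proof
    fix x assume "x \<in> grs a v k"
    then obtain p where p: "degree p < k" "x = (\<chi> i. v i * poly p (a i))"
      by (auto simp: grs_def)
    have "p = (\<Sum>j<k. monom (coeff p j) j)"
      using poly_as_sum_of_monoms'[of p "k - 1"] p(1) k(1)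
      by (simp add: lessThan_Suc_atMost[symmetric])
    then have "x = (\<Sum>j<k. coeff p j *s c j)"
      unfolding comb using p(2) by simp
    then show "x \<in> vec.span (c ` {..<k})"
      by (simp only:) (rule vec.span_sum, rule vec.span_scale, rule vec.span_base, rule imageI)
  qed
  ultimately show ?thesis
    using vec.basis_card_eq_dim[of "c ` {..<k}" "grs a v k"] card_image[OF injc] by simp
qed

text \<open>Two distinct codewords agree only at roots of a nonzero difference polynomial of degree
  below \<open>k\<close>, so in at most \<open>k - 1\<close> places.\<close>

lemma grs_min_dist:
  fixes a :: "'n::finite \<Rightarrow> 'a::field"
  assumes inj: "inj a" and v: "\<And>i. v i \<noteq> 0" and k: "0 < k" "k \<le> CARD('n)"
  shows "min_dist (grs a v k) = CARD('n) + 1 - k"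
proof -
  let ?D = "{hamming_dist x y | x y. x \<in> grs a v k \<and> y \<in> grs a v k \<and> x \<noteq> y}"
  have card_ne: "card {i. f i \<noteq> g i} = CARD('n) - card {i. f i = g i}" for f g :: "'n \<Rightarrow> 'a"
  proof -
    have "{i. f i \<noteq> g i} = UNIV - {i. f i = g i}"
      by auto
    then show ?thesis
      by (simp add: card_Diff_subset)
  qed
  have dist: "hamming_dist (\<chi> i. v i * poly p (a i)) (\<chi> i. v i * poly q (a i))
      = CARD('n) - card {i. poly p (a i) = poly q (a i)}" for p q
    using v by (simp add: hamming_dist_def card_ne)
  have "Min ?D = CARD('n) + 1 - k"
  proof (rule Min_eqI)
    have "?D \<subseteq> {..CARD('n)}"
      by (auto simp: hamming_dist_def intro: card_mono)
    then show "finite ?D"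
      by (rule finite_subset) simp
  next
    fix d assume "d \<in> ?D"
    then obtain p q where pq: "degree p < k" "degree q < k" "p \<noteq> q"
      and d: "d = CARD('n) - card {i. poly p (a i) = poly q (a i)}"
      unfolding grs_def using dist by auto
    have "card {i. poly p (a i) = poly q (a i)} = card (a ` {i. poly p (a i) = poly q (a i)})"
      using inj by (simp add: card_image inj_on_subset)
    also have "\<dots> \<le> card {x. poly (p - q) x = 0}"
      using pq by (intro card_mono poly_roots_finite) auto
    also have "\<dots> \<le> degree (p - q)"
      using pq by (intro card_poly_roots_bound) auto
    also have "\<dots> < k"
      using pq by (intro degree_diff_less)
    finally show "CARD('n) + 1 - k \<le> d"
      unfolding d by linarith
  next
    \<comment> \<open>The bound is attained by the zero word and the word of a product of
      \<open>k - 1\<close> linear factors.\<close>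
    have "k - 1 \<le> CARD('n)"
      using k by simp
    then obtain J :: "'n set" where J: "card J = k - 1"
      by (metis obtain_subset_with_card_n)
    define p where "p = (\<Prod>j\<in>J. [:- a j, 1:])"
    have p: "degree p < k" "p \<noteq> 0"
      using prod_linear_monic[of J a] J k by (auto simp: p_def)
    have "{i. poly p (a i) = 0} = J"
      using inj by (auto simp: p_def poly_prod inj_eq)
    then have "CARD('n) + 1 - k
        = hamming_dist (\<chi> i. v i * poly p (a i)) (\<chi> i. v i * poly 0 (a i))"
      unfolding dist using J k by simp
    moreover have "(\<chi> i. v i * poly p (a i)) \<in> grs a v k" "(\<chi> i. v i * poly 0 (a i)) \<in> grs a v k"
      unfolding grs_def using p k by (blast, intro CollectI exI[of _ 0]) auto
    moreover have "(\<chi> i. v i * poly p (a i)) \<noteq> (\<chi> i. v i * poly 0 (a i))"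
    proof
      assume "(\<chi> i. v i * poly p (a i)) = (\<chi> i. v i * poly 0 (a i))"
      then have "poly p (a i) = 0" for i
        using v by (simp add: vec_eq_iff)
      then show False
        using poly_eq_0_if_vanishes[OF inj, of p] p k by simp
    qed
    ultimately show "CARD('n) + 1 - k \<in> ?D"
      by (intro CollectI exI[of _ "\<chi> i. v i * poly p (a i)"]
          exI[of _ "\<chi> i. v i * poly 0 (a i)"]) (simp only: simp_thms)
  qed
  then show ?thesis
    by (simp add: min_dist_def)
qed

text \<open>The condition on \<open>v\<close> turns the bilinear form into a coefficient of
  \<open>p * q\<close>. For \<open>p\<close> and \<open>q\<close> of degree below \<open>k\<close>
  it lies beyond the degree, so the code is inside its dual; the converse tests a dual vector
  against monomials.\<close>

lemma grs_self_dual: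
  fixes a :: "'n::finite \<Rightarrow> 'a::field"
  assumes inj: "inj a" and n: "CARD('n) = 2 * k"
    and v: "\<And>i. v i ^ 2 * (\<Prod>j\<in>UNIV - {i}. a i - a j) = 1"
  shows "self_dual (grs a v k)"
proof -
  have k: "0 < k"
    using n by (metis finite_UNIV_card_ge_0 finite mult_0_right neq0_conv)
  define w where "w i = (\<Prod>j\<in>UNIV - {i}. a i - a j)" for i
  have v0: "v i \<noteq> 0" for i
    using v[of i] by auto
  have w0: "w i \<noteq> 0" for i
    using v[of i, folded w_def] by auto
  have vw: "v i * v i = 1 / w i" for i
    using v[of i, folded w_def] w0[of i] by (simp add: power2_eq_square eq_divide_eq)
  have form: "bilin_form (\<chi> i. v i * poly p (a i)) (\<chi> i. v i * poly q (a i))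
      = coeff (p * q) (2 * k - 1)" if "degree (p * q) < 2 * k" for p q
  proof -
    have "bilin_form (\<chi> i. v i * poly p (a i)) (\<chi> i. v i * poly q (a i))
        = (\<Sum>i\<in>UNIV. (v i * v i) * (poly p (a i) * poly q (a i)))"
      by (simp add: bilin_form_def mult_ac)
    also have "\<dots> = (\<Sum>i\<in>UNIV. poly (p * q) (a i) / w i)"
      by (simp add: vw)
    also have "\<dots> = coeff (p * q) (2 * k - 1)"
      using sum_Lagrange_weights[of UNIV a "p * q"] inj that n by (simp add: w_def)
    finally show ?thesis .
  qed
  have "x \<in> dual_code (grs a v k)" if "x \<in> grs a v k" for x
    unfolding dual_code_def
  proof (intro CollectI ballI)
    fix y assume "y \<in> grs a v k"
    then obtain p q where pq: "degree p < k" "degree q < k"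
      "x = (\<chi> i. v i * poly p (a i))" "y = (\<chi> i. v i * poly q (a i))"
      using \<open>x \<in> grs a v k\<close> by (auto simp: grs_def)
    have "degree (p * q) < 2 * k - 1"
      using degree_mult_le[of p q] pq by linarith
    then show "bilin_form x y = 0"
      using pq form[of p q] by (simp add: coeff_eq_0)
  qed
  moreover have "x \<in> grs a v k" if x: "x \<in> dual_code (grs a v k)" for x
  proof -
    \<comment> \<open>Every vector is the word of its interpolant \<open>P\<close> of degree at most
      \<open>2 * k - 1\<close>; the task is to lower this bound below \<open>k\<close>.\<close>
    define L where "L i = (\<Prod>j\<in>UNIV - {i}. [:- a j, 1:])" for i
    define P where "P = (\<Sum>i\<in>UNIV. smult (x $ i / v i / w i) (L i))"
    have LL: "poly (L i) (a j) = (if i = j then w i else 0)" for i j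
      by (auto simp: L_def w_def poly_prod)
    have "poly P (a j) = (\<Sum>i\<in>UNIV. if i = j then x $ i / v i else 0)" for j
      unfolding P_def poly_sum by (intro sum.cong refl) (auto simp: LL w0)
    then have xP: "x = (\<chi> i. v i * poly P (a i))"
      by (simp add: vec_eq_iff v0)
    have "degree (L i) = 2 * k - 1" for i
      using prod_linear_monic(1)[of "UNIV - {i}" a] by (simp add: L_def n)
    then have degP: "degree P \<le> 2 * k - 1"
      unfolding P_def by (intro degree_sum_le order.trans[OF degree_smult_le]) auto
    have "degree P < k"
    proof (rule ccontr)
      assume "\<not> degree P < k"
      then have big: "k \<le> degree P" "P \<noteq> 0"
        using k by auto
      \<comment> \<open>Pairing with a monomial of complementary degree detects the leading coefficient.\<close>
      define e where "e = 2 * k - 1 - degree P"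
      have e: "e < k" "degree P + e = 2 * k - 1"
        using big degP k by (auto simp: e_def)
      have "(\<chi> i. v i * poly (monom 1 e) (a i)) \<in> grs a v k"
        unfolding grs_def using e by (intro CollectI exI[of _ "monom 1 e"]) (simp add: degree_monom_eq)
      then have "0 = bilin_form x (\<chi> i. v i * poly (monom 1 e) (a i))"
        using x by (simp add: dual_code_def)
      also have "\<dots> = coeff (P * monom 1 e) (2 * k - 1)"
        unfolding xP using e k degree_mult_le[of P "monom 1 e"]
        by (intro form) (simp add: degree_monom_eq)
      also have "\<dots> = lead_coeff P"
        using e(2)[symmetric] by (simp add: mult.commute[of P] coeff_monom_mult)
      finally show False
        using big by simp
    qed
    then show ?thesis
      using xP by (auto simp: grs_def)
  qed
  ultimately show ?thesis
    by (auto simp: self_dual_def)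
qed

text \<open>The inverses of square roots of the products serve as column multipliers, after
  labelling \<open>S\<close> by the index type.\<close>

lemma MDS_self_dual_of_square_differences:
  fixes S :: "'a::field set"
  assumes S: "card S = CARD('n::finite)" and n: "CARD('n) = 2 * k"
    and sq: "\<And>x. x \<in> S \<Longrightarrow> \<exists>z. z ^ 2 = (\<Prod>y\<in>S - {x}. x - y)"
  shows "\<exists>C :: ('a ^ 'n) set. linear_code CARD('n) k C \<and> MDS C \<and> self_dual C"
proof -
  have k: "0 < k"
    using n by (metis finite_UNIV_card_ge_0 finite mult_0_right neq0_conv)
  have "finite S"
    using S by (intro card_ge_0_finite) simp
  then obtain a :: "'n \<Rightarrow> 'a" where a: "bij_betw a UNIV S"
    using finite_same_card_bij[of "UNIV :: 'n set" S] S by auto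
  have inj: "inj a"
    using a by (simp add: bij_betw_def)
  define w where "w i = (\<Prod>j\<in>UNIV - {i}. a i - a j)" for i
  have "w i = (\<Prod>y\<in>S - {a i}. a i - y)" for i
  proof -
    have "a ` (UNIV - {i}) = S - {a i}"
      using a inj by (auto simp: bij_betw_def inj_eq)
    moreover have "inj_on a (UNIV - {i})"
      using inj by (rule inj_on_subset) simp
    ultimately show ?thesis
      unfolding w_def using prod.reindex[of a "UNIV - {i}" "\<lambda>y. a i - y"] by simp
  qed
  then have "\<exists>z. z ^ 2 = w i" for i
    using sq[of "a i"] a by (auto simp: bij_betw_def)
  then obtain z where z: "\<And>i. z i ^ 2 = w i"
    by metis
  define v where "v i = inverse (z i)" for i
  have "w i \<noteq> 0" for i
    using inj by (auto simp: w_def inj_eq)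
  then have vw: "v i ^ 2 * w i = 1" for i
    using z[of i] by (simp add: v_def power_inverse)
  then have v0: "v i \<noteq> 0" for i
    by (metis mult_zero_left power_zero_numeral zero_neq_one)
  let ?C = "grs a v k"
  have "vec.dim ?C = k" "min_dist ?C = CARD('n) + 1 - k"
    using grs_dim[OF inj v0] grs_min_dist[OF inj v0] k n by auto
  then have "linear_code CARD('n) k ?C \<and> MDS ?C"
    using grs_subspace[OF k] k n by (simp add: linear_code_def MDS_def)
  moreover have "self_dual ?C"
    using vw by (intro grs_self_dual inj n) (simp add: w_def)
  ultimately show ?thesis
    by blast
qed

section \<open>Powers in finite fields\<close>

text \<open>Multiplication by \<open>x\<close> permutes the nonzero elements, so their product can
  be cancelled.\<close>

lemma finite_field_power_card_minus_1:
  fixes x :: "'a::{field,finite}"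
  assumes "x \<noteq> 0"
  shows "x ^ (CARD('a) - 1) = 1"
proof -
  have "(\<Prod>y\<in>UNIV - {0}. x * y) = (\<Prod>y\<in>UNIV - {0}. y)"
    by (rule prod.reindex_bij_witness[of _ "\<lambda>y. y / x" "\<lambda>y. x * y"]) (use assms in auto)
  then show ?thesis
    by (simp add: prod.distrib card_Diff_singleton)
qed

lemma card_power_eq_le:
  fixes y :: "'a::idom"
  assumes "0 < d"
  shows "card {x. x ^ d = y} \<le> d"
proof -
  let ?p = "monom 1 d - [:y:]"
  have "coeff ?p d = 1"
    using assms by (simp add: coeff_pCons split: nat.split)
  then have "?p \<noteq> 0"
    by (metis coeff_0 zero_neq_one)
  then have "card {x. poly ?p x = 0} \<le> degree ?p"
    by (rule card_poly_roots_bound)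
  also have "\<dots> \<le> d"
    by (intro degree_diff_le) (auto simp: degree_monom_le)
  finally show ?thesis
    by (simp add: poly_monom)
qed

text \<open>With \<open>CARD('a) - 1 = d * e\<close>, all nonzero elements are roots of
  \<open>X ^ (d * e) - 1 = (X ^ d - 1) * g\<close>. The cofactor \<open>g\<close> has at most
  \<open>d * (e - 1)\<close> roots, which leaves at least \<open>d\<close> for
  \<open>X ^ d - 1\<close>.\<close>

lemma card_roots_of_unity:
  assumes "d dvd CARD('a::{field,finite}) - 1"
  shows "card {x :: 'a. x ^ d = 1} = d"
proof -
  have "card {0, 1 :: 'a} \<le> CARD('a)"
    by (intro card_mono) auto
  then have q: "CARD('a) \<ge> 2"
    by simp
  obtain e where e: "CARD('a) - 1 = d * e"
    using assms by auto
  then have de: "0 < d" "0 < e"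
    using q by (auto intro!: Nat.gr0I)
  define g :: "'a poly" where "g = (\<Sum>j<e. monom 1 (d * j))"
  have g: "poly g x = (\<Sum>j<e. (x ^ d) ^ j)" for x
    by (simp add: g_def poly_sum poly_monom power_mult)
  have "coeff g 0 = (\<Sum>j<e. if j = 0 then 1 else 0)"
    unfolding g_def coeff_sum using de by (intro sum.cong) auto
  then have "g \<noteq> 0"
    using de by auto
  then have "card {x. poly g x = 0} \<le> degree g"
    by (rule card_poly_roots_bound)
  also have "\<dots> \<le> d * (e - 1)"
    unfolding g_def
    by (intro degree_sum_le order.trans[OF degree_monom_le]) (auto intro!: mult_le_mono)
  finally have cg: "card {x. poly g x = 0} \<le> d * (e - 1)" .
  have "UNIV - {0} \<subseteq> {x :: 'a. x ^ d = 1} \<union> {x. poly g x = 0}"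
  proof
    fix x :: 'a assume "x \<in> UNIV - {0}"
    then have "(x ^ d) ^ e = 1"
      using finite_field_power_card_minus_1[of x] unfolding e power_mult by simp
    then have "x ^ d = 1 \<or> poly g x = 0"
      using geometric_sum[of "x ^ d" e] by (auto simp: g)
    then show "x \<in> {x :: 'a. x ^ d = 1} \<union> {x. poly g x = 0}"
      by auto
  qed
  then have "card (UNIV - {0 :: 'a}) \<le> card ({x :: 'a. x ^ d = 1} \<union> {x. poly g x = 0})"
    by (intro card_mono) auto
  also have "\<dots> \<le> card {x :: 'a. x ^ d = 1} + card {x. poly g x = 0}"
    by (rule card_Un_le)
  finally have "d * e \<le> card {x :: 'a. x ^ d = 1} + d * (e - 1)"
    using cg e by (simp add: card_Diff_singleton)
  moreover have "d * e = d + d * (e - 1)"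
    using de by (cases e) auto
  ultimately have "d \<le> card {x :: 'a. x ^ d = 1}"
    by linarith
  then show ?thesis
    using card_power_eq_le[OF de(1), of "1 :: 'a"] by simp
qed

text \<open>The fibres of \<open>x \<mapsto> x ^ e\<close> from the \<open>e * d\<close>-th to the \<open>d\<close>-th roots of unity have at most
  \<open>e\<close> elements each, so by counting they have exactly \<open>e\<close> elements.\<close>

lemma card_power_fibre:
  fixes y :: "'a::{field,finite}"
  assumes ed: "e * d dvd CARD('a) - 1" and y: "y ^ d = 1"
  shows "card {x. x ^ e = y} = e"
proof -
  have "card {0, 1 :: 'a} \<le> CARD('a)"
    by (intro card_mono) auto
  then have q: "CARD('a) \<ge> 2"
    by simp
  then have e: "0 < e"
    using ed by (auto intro!: Nat.gr0I)
  let ?Y = "{y :: 'a. y ^ d = 1}" and ?F = "\<lambda>y. {x :: 'a. x ^ e = y}"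
  have d: "card ?Y = d"
    using ed by (intro card_roots_of_unity) (auto dest: dvd_mult_right)
  have "{x :: 'a. x ^ (e * d) = 1} = (\<Union>y\<in>?Y. ?F y)"
    by (auto simp: power_mult)
  then have "e * d = card (\<Union>y\<in>?Y. ?F y)"
    using card_roots_of_unity[OF ed] by simp
  also have "\<dots> = (\<Sum>y\<in>?Y. card (?F y))"
    by (intro card_UN_disjoint) auto
  finally have sum: "(\<Sum>y\<in>?Y. card (?F y)) = e * d" ..
  show ?thesis
  proof (rule ccontr)
    assume "card {x. x ^ e = y} \<noteq> e"
    then have "card (?F y) < e"
      using card_power_eq_le[OF e, of y] by simp
    then have "(\<Sum>y\<in>?Y. card (?F y)) < (\<Sum>y\<in>?Y. e)"
      using y by (intro sum_strict_mono_ex1) (auto intro: card_power_eq_le[OF e])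
    then show False
      using sum d by simp
  qed
qed

text \<open>One direction of Euler's criterion, as the fibre count for \<open>e = 2\<close>.\<close>

lemma finite_field_square_criterion:
  fixes x :: "'a::{field,finite}"
  assumes "odd CARD('a)" "x ^ ((CARD('a) - 1) div 2) = 1"
  shows "\<exists>z. z ^ 2 = x"
proof -
  have "card {z. z ^ 2 = x} = 2"
    using assms by (intro card_power_fibre[of _ "(CARD('a) - 1) div 2"]) auto
  then have "{z. z ^ 2 = x} \<noteq> {}"
    by (metis card.empty zero_neq_numeral)
  then show ?thesis
    by blast
qed

text \<open>Translation by 1 permutes the ring, so it leaves the sum of all elements
  unchanged.\<close>

lemma of_nat_CARD_eq_0: "of_nat CARD('a) = (0 :: 'a::{ring_1,finite})"
proof -
  have "(\<Sum>x\<in>UNIV. x + 1) = (\<Sum>x\<in>UNIV. x :: 'a)"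
    by (rule sum.reindex_bij_witness[of _ "\<lambda>x. x - 1" "\<lambda>x. x + 1"]) auto
  then show ?thesis
    by (simp add: sum.distrib)
qed

lemma CHAR_eq_of_CARD_eq_prime_power:
  assumes p: "prime p" and card: "CARD('a::{field,finite}) = p ^ l"
  shows "CHAR('a) = p"
proof -
  have "CHAR('a) > 0"
    by (rule finite_imp_CHAR_pos) simp
  then have "prime CHAR('a)"
    by (rule prime_CHAR_semidom)
  moreover have "CHAR('a) dvd p ^ l"
    using of_nat_CARD_eq_0[where 'a = 'a] card by (simp only: of_nat_eq_0_iff_char_dvd)
  ultimately show ?thesis
    using p by (metis prime_dvd_power primes_dvd_imp_eq)
qed

section \<open>The evaluation points\<close>

text \<open>\<open>F\<close> must be the product of the linear factors over \<open>S\<close>; in its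
  derivative at \<open>x\<close> only the term that loses the factor vanishing at \<open>x\<close>
  survives.\<close>

lemma poly_pderiv_eq_prod_diff:
  fixes F :: "'a::field poly"
  assumes S: "finite S" and x: "x \<in> S"
    and F: "degree F = card S" "lead_coeff F = 1" "\<And>y. y \<in> S \<Longrightarrow> poly F y = 0"
  shows "poly (pderiv F) x = (\<Prod>y\<in>S - {x}. x - y)"
proof -
  have "F = (\<Prod>y\<in>S. [:- y, 1:])"
    using prod_linear_monic[OF S, of "\<lambda>y. y"] F S
    by (intro poly_eqI_degree_lead_coeff[of _ "card S" _ S]) (auto simp: poly_prod)
  also have "\<dots> = [:- x, 1:] * (\<Prod>y\<in>S - {x}. [:- y, 1:])"
    using S x by (rule prod.remove)
  finally show ?thesis
    by (simp only: pderiv_mult poly_add poly_mult poly_prod) (simp add: pderiv_pCons)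
qed

text \<open>\<open>S\<close> is the root set of \<open>X * f\<close> with
  \<open>f = (\<Prod>u\<in>U. X ^ m - u)\<close>. Full fibres make its size equal to the degree, so
  the derivative \<open>f + X * f'\<close> gives the products.\<close>

lemma weights_of_power_preimage:
  fixes U :: "'a::field set"
  assumes m: "0 < m" and U: "finite U" "0 \<notin> U"
    and fibre: "\<And>u. u \<in> U \<Longrightarrow> card {x. x ^ m = u} = m"
  defines "S \<equiv> insert 0 {x. x ^ m \<in> U}"
  shows "card S = card U * m + 1"
    and "(\<Prod>y\<in>S - {0}. 0 - y) = (\<Prod>u\<in>U. - u)"
    and "x ^ m \<in> U \<Longrightarrow>
      (\<Prod>y\<in>S - {x}. x - y) = of_nat m * x ^ m * (\<Prod>u\<in>U - {x ^ m}. x ^ m - u)"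
proof -
  have fin: "finite {x. x ^ m = u}" if "u \<in> U" for u
    using fibre[OF that] m by (intro card_ge_0_finite) simp
  have eq: "{x. x ^ m \<in> U} = (\<Union>u\<in>U. {x. x ^ m = u})"
    by auto
  have "card {x. x ^ m \<in> U} = (\<Sum>u\<in>U. card {x. x ^ m = u})"
    unfolding eq using U fin by (intro card_UN_disjoint) auto
  moreover have finS': "finite {x. x ^ m \<in> U}"
    unfolding eq using U fin by auto
  ultimately show cardS: "card S = card U * m + 1"
    using U m fibre by (simp add: S_def card_insert_if power_0_left)
  have finS: "finite S"
    using finS' by (simp add: S_def)
  define h where "h u = monom 1 m - [:u:]" for u :: 'a
  define f where "f = (\<Prod>u\<in>U. h u)"
  have ch: "coeff (h u) m = 1" for u
    using m by (simp add: h_def coeff_pCons split: nat.split)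
  have degh: "degree (h u) = m" for u
  proof (rule antisym)
    show "degree (h u) \<le> m"
      unfolding h_def by (intro degree_diff_le) (auto simp: degree_monom_le)
    show "m \<le> degree (h u)"
      using ch[of u] by (intro le_degree) simp
  qed
  have h0: "h u \<noteq> 0" for u
    using ch[of u] by auto
  have ph: "poly (h u) y = y ^ m - u" for u y
    by (simp add: h_def poly_monom)
  have f0: "f \<noteq> 0"
    using U h0 by (simp add: f_def)
  have degf: "degree f = card U * m"
    unfolding f_def using h0 by (subst degree_prod_eq_sum_degree) (auto simp: degh)
  have lcf: "lead_coeff f = 1"
    unfolding f_def using ch by (simp add: lead_coeff_prod degh)
  have "degree (pCons 0 f) = card S" "lead_coeff (pCons 0 f) = 1"
    using f0 degf lcf cardS by auto
  moreover have "poly (pCons 0 f) y = 0" if "y \<in> S" for y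
    using that U by (auto simp: S_def f_def poly_prod ph)
  ultimately have w: "(\<Prod>y\<in>S - {x}. x - y) = poly f x + x * poly (pderiv f) x" if "x \<in> S" for x
    using poly_pderiv_eq_prod_diff[OF finS that, of "pCons 0 f"] by (simp add: pderiv_pCons)
  show "(\<Prod>y\<in>S - {0}. 0 - y) = (\<Prod>u\<in>U. - u)"
    using w[of 0] m by (simp add: S_def f_def poly_prod ph power_0_left)
  show "(\<Prod>y\<in>S - {x}. x - y) = of_nat m * x ^ m * (\<Prod>u\<in>U - {x ^ m}. x ^ m - u)"
    if x: "x ^ m \<in> U"
  proof -
    have f: "f = h (x ^ m) * (\<Prod>u\<in>U - {x ^ m}. h u)"
      unfolding f_def using U(1) x by (rule prod.remove)
    \<comment> \<open>The factor \<open>x\<close> raises \<open>x ^ (m - 1)\<close> to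
      \<open>x ^ m\<close>, so the result depends on \<open>x ^ m\<close> alone.\<close>
    have "x * poly (pderiv (h (x ^ m))) x = of_nat m * x ^ m"
      using m by (cases m) (simp_all add: h_def pderiv_diff pderiv_monom poly_monom pderiv_pCons mult_ac)
    then have "x * poly (pderiv f) x = of_nat m * x ^ m * (\<Prod>u\<in>U - {x ^ m}. x ^ m - u)"
      unfolding f by (simp add: pderiv_mult ph poly_prod algebra_simps)
    moreover have "poly f x = 0"
      unfolding f by (simp add: ph)
    ultimately show ?thesis
      using w[of x] x by (simp add: S_def)
  qed
qed

theorem theorem2:
  fixes q r m t n :: nat
  assumes "primepow r" and "odd r" and "q = r ^ 2"
    and "CARD('a::{field,finite}) = q"
    and "m > 0" and "m dvd q - 1"
    and "1 \<le> t" and "real t \<le> (real r + 1) / (2 * real (gcd (r + 1) m))"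
    and "odd (t * m)" and "n = t * m + 1"
    and "CARD('n::finite) = n"
  shows "\<exists>C :: ('a ^ 'n) set. linear_code n (n div 2) C \<and> MDS C \<and> self_dual C"
proof -
  obtain D where D: "r + 1 = 2 * D"
    using \<open>odd r\<close> by (metis dvd_def even_plus_one_iff)
  have odd: "odd t" "odd m"
    using \<open>odd (t * m)\<close> by auto
  define g where "g = gcd D m"
  \<comment> \<open>As \<open>m\<close> is odd, the factor 2 of \<open>r + 1\<close> drops out of
    the gcd, and the bound on \<open>t\<close> becomes \<open>t \<le> E\<close>.\<close>
  have g: "gcd (r + 1) m = g"
    unfolding D g_def using odd(2) by (simp add: gcd_mult_left_left_cancel coprime_commute)
  obtain E where E: "D = g * E"
    unfolding g_def by (metis dvd_def gcd_dvd1)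
  have "0 < g"
    using \<open>m > 0\<close> by (simp add: g_def)
  have "real r + 1 = 2 * (real g * real E)"
    using D E by (metis of_nat_1 of_nat_add of_nat_mult of_nat_numeral)
  then have "real t \<le> real E"
    using assms(8) \<open>0 < g\<close> unfolding g by (simp add: field_simps)
  then have tE: "t \<le> E"
    by simp
  have q1: "q - 1 = (r - 1) * (r + 1)"
    using \<open>q = r ^ 2\<close> by (cases r) (auto simp: power2_eq_square)
  then have q3: "q - 1 = 2 * ((r - 1) * D)"
    unfolding D by (simp only: mult_ac)
  then have q2: "(q - 1) div 2 = (r - 1) * D"
    by simp
  have r1: "even (r - 1)"
    using \<open>odd r\<close> by simp
  have cardq: "CARD('a) - 1 = q - 1"
    using assms(4) by simp
  have oddq: "odd CARD('a)"
    using assms by simp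

  \<comment> \<open>The Euler exponent \<open>(q - 1) div 2\<close> in factored form:
    \<open>D\<close> takes care of the elements of \<open>U\<close>, \<open>r - 1\<close> of the
    nonzero elements fixed by the \<open>r\<close>-th power.\<close>
  define sq where "sq x \<longleftrightarrow> x ^ ((r - 1) * D) = 1" for x :: 'a
  have sqI: "\<exists>z. z ^ 2 = x" if "sq x" for x
    using finite_field_square_criterion[OF oddq, of x] that unfolding sq_def cardq q2 by simp
  have sq_mult: "sq (x * y)" if "sq x" "sq y" for x y
    using that by (simp add: sq_def power_mult_distrib)
  have sq_minus: "sq (- x)" if "sq x" for x
    using that r1 by (simp add: sq_def)
  have sq_prod: "sq (prod f A)" if "\<And>x. x \<in> A \<Longrightarrow> sq (f x)" for f :: "'a \<Rightarrow> 'a" and A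
    using that by (simp add: sq_def prod_power_distrib)

  \<comment> \<open>Here \<open>m * E\<close> is \<open>lcm D m\<close>. This divisibility supplies
    both the \<open>E\<close>-th roots of unity and the full fibres of \<open>x ^ m\<close> over
    them.\<close>
  have Em: "m * E dvd q - 1"
  proof -
    have "g * lcm D m = D * m"
      unfolding g_def by (rule prod_gcd_lcm_nat[symmetric])
    also have "\<dots> = g * (m * E)"
      by (subst E) (simp only: mult_ac)
    finally have "m * E = lcm D m"
      using \<open>0 < g\<close> by simp
    also have "lcm D m dvd q - 1"
      using \<open>m dvd q - 1\<close> q3 by (intro lcm_least) auto
    finally show ?thesis .
  qed
  have "card {u :: 'a. u ^ E = 1} = E"
    using Em unfolding cardq[symmetric] by (intro card_roots_of_unity) (rule dvd_mult_right)
  then obtain U :: "'a set" where U: "U \<subseteq> {u. u ^ E = 1}" "card U = t" "finite U"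
    using tE by (metis obtain_subset_with_card_n)
  have U0: "0 \<notin> U"
    using U(1) tE \<open>1 \<le> t\<close> by (auto simp: power_0_left)
  have uD: "u ^ D = 1" if "u \<in> U" for u
    using U(1) that by (auto simp: E mult.commute[of g] power_mult)
  have sq_u: "sq u" if "u \<in> U" for u
    using uD[OF that] by (simp add: sq_def mult.commute[of _ D] power_mult)

  obtain p l where p: "prime p" "r = p ^ l"
    using \<open>primepow r\<close> by (auto simp: primepow_def)
  have char: "CHAR('a) = p"
    using p assms(3,4) by (intro CHAR_eq_of_CARD_eq_prime_power[of _ "l * 2"]) (auto simp: power_mult)
  have frob: "(x + y) ^ r = x ^ r + y ^ r" for x y :: 'a
    by (rule freshmans_dream') (use p char in auto)
  have frob_minus: "(x - y) ^ r = x ^ r - y ^ r" for x y :: 'a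
    using frob[of "x - y" y] by (simp add: algebra_simps)
  have rpos: "r = Suc (r - 1)"
    using \<open>odd r\<close> by (cases r) auto

  have sq_m: "sq (of_nat m)"
  proof -
    have "(of_nat j :: 'a) ^ r = of_nat j" for j
      using odd_pos[OF \<open>odd r\<close>] by (induction j) (auto simp: frob power_0_left)
    \<comment> \<open>Otherwise \<open>q - 1\<close> would vanish in the field along with its
      divisor \<open>m\<close>, but so does \<open>q\<close>.\<close>
    moreover have "(of_nat m :: 'a) \<noteq> 0"
    proof
      assume "(of_nat m :: 'a) = 0"
      moreover obtain c where c: "q - 1 = m * c"
        using \<open>m dvd q - 1\<close> by auto
      ultimately have "(of_nat (q - 1) :: 'a) = 0"
        by simp
      moreover have "(of_nat q :: 'a) = 0"
        using of_nat_CARD_eq_0[where 'a = 'a] assms(4) by simp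
      moreover have "q = Suc (q - 1)"
        using oddq assms(4) by (cases q) auto
      ultimately show False
        by (metis add.right_neutral of_nat_Suc zero_neq_one)
    qed
    moreover have "(of_nat m :: 'a) ^ r = of_nat m * of_nat m ^ (r - 1)"
      by (subst rpos) (rule power_Suc)
    ultimately have "(of_nat m :: 'a) ^ (r - 1) = 1"
      by simp
    then show ?thesis
      by (simp add: sq_def power_mult)
  qed

  \<comment> \<open>As \<open>u ^ r = inverse u\<close> on \<open>U\<close>, all differences of distinct elements of \<open>U\<close> have the same
     quadratic character.\<close>
  have diff: "(u - v) ^ ((r - 1) * D) = (- 1) ^ D" if uv: "u \<in> U" "v \<in> U" "u \<noteq> v" for u v
  proof -
    have inv: "w ^ r * w = 1" if "w \<in> U" for w
    proof -
      have "w ^ (r + 1) = 1"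
        using uD[OF that] unfolding D by (simp add: mult.commute[of 2] power_mult)
      then show ?thesis
        by (simp add: mult.commute)
    qed
    \<comment> \<open>Multiplying by \<open>u * v\<close> clears the inverses:
      \<open>(u - v) ^ r * (u * v) = v - u\<close>.\<close>
    have "(u - v) * ((u - v) ^ (r - 1) * (u * v)) = (u - v) ^ r * (u * v)"
      by (subst (2) rpos) (simp add: mult_ac)
    also have "\<dots> = (u ^ r * u) * v - (v ^ r * v) * u"
      by (simp add: frob_minus algebra_simps)
    also have "\<dots> = (u - v) * (- 1)"
      using inv uv by simp
    finally have "(u - v) ^ (r - 1) * (u * v) = - 1"
      using uv(3) by (simp only: mult_cancel_left) simp
    then have "((u - v) ^ (r - 1)) ^ D * (u ^ D * v ^ D) = (- 1) ^ D"
      by (metis power_mult_distrib)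
    then show ?thesis
      using uD uv by (simp add: power_mult)
  qed
  have sq_diff: "sq (\<Prod>v\<in>U - {u}. u - v)" if u: "u \<in> U" for u
  proof -
    have "(\<Prod>v\<in>U - {u}. u - v) ^ ((r - 1) * D) = (\<Prod>v\<in>U - {u}. (- 1) ^ D)"
      unfolding prod_power_distrib using u diff by (intro prod.cong) auto
    also have "\<dots> = ((- 1) ^ D) ^ (t - 1)"
      using U u by (simp add: card_Diff_singleton)
    \<comment> \<open>Since \<open>t - 1\<close> is even, the sign disappears whatever the parity of
      \<open>D\<close>.\<close>
    also have "\<dots> = ((- 1) ^ (t - 1)) ^ D"
      by (metis power_mult mult.commute)
    also have "\<dots> = 1"
      using odd by simp
    finally show ?thesis
      by (simp add: sq_def)
  qed

  have fibre: "card {x. x ^ m = u} = m" if "u \<in> U" for u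
    using Em U(1) that unfolding cardq[symmetric] by (intro card_power_fibre[of m E]) auto
  define S where "S = insert 0 {x. x ^ m \<in> U}"
  note weights = weights_of_power_preimage[OF \<open>m > 0\<close> U(3) U0 fibre, folded S_def]
  have "card S = CARD('n)"
    using weights(1) U(2) assms by simp
  moreover have "CARD('n) = 2 * (n div 2)"
    using assms by simp
  moreover have "\<exists>z. z ^ 2 = (\<Prod>y\<in>S - {x}. x - y)" if "x \<in> S" for x
  proof (cases "x = 0")
    case True
    then show ?thesis
      using weights(2) sq_u by (auto intro!: sqI sq_prod sq_minus)
  next
    case False
    then have "x ^ m \<in> U"
      using \<open>x \<in> S\<close> by (simp add: S_def)
    then show ?thesis
      using weights(3)[of x] sq_m sq_u sq_diff by (auto intro!: sqI sq_mult)
  qed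
  ultimately show ?thesis
    using MDS_self_dual_of_square_differences[of S "n div 2", where 'n = 'n] assms by simp
qed

end
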